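(* Let $G$ be a finitely generated recursively presented group. The class of effectively closed subshifts on $G$ is closed under finite unions: if $n\ge 1$ and $X_i\subset A_i^G$ ($1\le i\le n$) are effectively closed subshifts over finite alphabets $A_i$, then, regarding all $X_i$ as subsets of $A^G$ with $A=\bigcup_i A_i$, the union $\bigcup_{i=1}^n X_i\subset A^G$ is an effectively closed subshift.
   Context: Let $S\subset G$ be a finite generating set closed under inverses and containing $1_G$; words in $S^*$ represent elements of $G$. $G$ is recursively presented if it has a presentation $\langle S\mid R\rangle$ with $S$ finite and $R\subset S^*$ recursively enumerable. For a finite alphabet $A$, $A^G$ has the product topology and left shift action $(\sigma_g x)_h=x_{g^{-1}h}$; a subshift is a closed shift-invariant subset. Put $[a]_g=\{x\in A^G:x_g=a\}$. A pattern coding over $A$ is a finite set $c$ of pairs $(w,a)$ with $w\in S^*$, $a\in A$. For a set $\mathcal C$ of pattern codings, $X_{\mathcal C}=\bigcap_{g\in G,\,c\in\mathcal C}\big(A^G\setminus\bigcap_{(w,a)\in c}[a]_{gw}\big)$. $X\subset A^G$ is effectively closed if $X=X_{\mathcal C}$ for some recursively enumerable set $\mathcal C$ of pattern codings over $A$. *)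

theory Defs
  imports
    "HOL-Algebra.Generated_Groups"
    "HOL-Analysis.Function_Topology"
    "HOL-Library.Nat_Bijection"
begin

section \<open>Recursively enumerable sets\<close>

text \<open>Total recursive functions of arity \<open>n\<close>: minimisation is only applied to functions that
  have a zero for every choice of parameters. Only the values on argument lists of length \<open>n\<close>
  are meaningful.\<close>

inductive recursive :: "nat \<Rightarrow> (nat list \<Rightarrow> nat) \<Rightarrow> bool" where
  zero: "recursive n (\<lambda>_. 0)"
| succ: "recursive 1 (\<lambda>xs. Suc (hd xs))"
| proj: "i < n \<Longrightarrow> recursive n (\<lambda>xs. xs ! i)"
| comp: "recursive (length gs) f \<Longrightarrow> (\<And>g. g \<in> set gs \<Longrightarrow> recursive n g) \<Longrightarrow>
    recursive n (\<lambda>xs. f (map (\<lambda>g. g xs) gs))"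
| prim_rec: "recursive n f \<Longrightarrow> recursive (Suc (Suc n)) g \<Longrightarrow>
    recursive (Suc n) (\<lambda>xs. rec_nat (f (tl xs)) (\<lambda>k r. g (k # r # tl xs)) (hd xs))"
| minim: "recursive (Suc n) f \<Longrightarrow> (\<And>xs. length xs = n \<Longrightarrow> \<exists>y. f (y # xs) = 0) \<Longrightarrow>
    recursive n (\<lambda>xs. LEAST y. f (y # xs) = 0)"

definition rec_enum :: "nat set \<Rightarrow> bool" where
  "rec_enum B \<longleftrightarrow> B = {} \<or> (\<exists>f. recursive 1 f \<and> B = range (\<lambda>k. f [k]))"

text \<open>Sets of words over a finite alphabet, and of pattern codings, are transported to sets of
  natural numbers by numbering the letters. Any two numberings of a finite alphabet differ by a
  finite, hence recursive, function, so quantifying over all numberings is the same as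
  choosing one.\<close>

definition rec_enum_words :: "'s set \<Rightarrow> 's list set \<Rightarrow> bool" where
  "rec_enum_words S R \<longleftrightarrow>
     (\<forall>e. inj_on e S \<longrightarrow> rec_enum ((\<lambda>w. list_encode (map e w)) ` R))"

definition coding_encode :: "('s \<Rightarrow> nat) \<Rightarrow> ('a \<Rightarrow> nat) \<Rightarrow> ('s list \<times> 'a) set \<Rightarrow> nat" where
  "coding_encode e d c = set_encode ((\<lambda>(w, a). prod_encode (list_encode (map e w), d a)) ` c)"

definition rec_enum_codings :: "'s set \<Rightarrow> 'a set \<Rightarrow> ('s list \<times> 'a) set set \<Rightarrow> bool" where
  "rec_enum_codings S A C \<longleftrightarrow>
     (\<forall>e d. inj_on e S \<longrightarrow> inj_on d A \<longrightarrow> rec_enum (coding_encode e d ` C))"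

section \<open>Generating sets and presentations\<close>

definition word_val :: "('g, 'b) monoid_scheme \<Rightarrow> 'g list \<Rightarrow> 'g" where
  "word_val G w = foldr (mult G) w \<one>\<^bsub>G\<^esub>"

definition sym_generating_set :: "('g, 'b) monoid_scheme \<Rightarrow> 'g set \<Rightarrow> bool" where
  "sym_generating_set G S \<longleftrightarrow>
     finite S \<and> S \<subseteq> carrier G \<and> \<one>\<^bsub>G\<^esub> \<in> S \<and> (\<forall>s\<in>S. inv\<^bsub>G\<^esub> s \<in> S) \<and> generate G S = carrier G"

text \<open>A signed letter \<open>(s, True)\<close> stands for the free generator \<open>s\<close>, and \<open>(s, False)\<close> for its
  formal inverse. The equivalence relation generated by \<open>pres_step S R\<close> is equality in the
  quotient of the free group on \<open>S\<close> by the normal closure of \<open>R\<close>.\<close>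

inductive pres_step :: "'s set \<Rightarrow> 's list set \<Rightarrow> ('s \<times> bool) list \<Rightarrow> ('s \<times> bool) list \<Rightarrow> bool"
  for S R where
  cancel: "s \<in> S \<Longrightarrow> pres_step S R (u @ [(s, b), (s, \<not> b)] @ v) (u @ v)"
| relator: "r \<in> R \<Longrightarrow> pres_step S R (u @ map (\<lambda>s. (s, True)) r @ v) (u @ v)"

definition signed_val :: "('g, 'b) monoid_scheme \<Rightarrow> ('g \<times> bool) list \<Rightarrow> 'g" where
  "signed_val G w = word_val G (map (\<lambda>(s, b). if b then s else inv\<^bsub>G\<^esub> s) w)"

definition presentation :: "('g, 'b) monoid_scheme \<Rightarrow> 'g set \<Rightarrow> 'g list set \<Rightarrow> bool" where
  "presentation G S R \<longleftrightarrow>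
     S \<subseteq> carrier G \<and> generate G S = carrier G \<and> R \<subseteq> lists S \<and>
     (\<forall>w \<in> lists (S \<times> UNIV). signed_val G w = \<one>\<^bsub>G\<^esub> \<longleftrightarrow> equivclp (pres_step S R) w [])"

definition recursively_presented :: "('g, 'b) monoid_scheme \<Rightarrow> bool" where
  "recursively_presented G \<longleftrightarrow>
     (\<exists>S R. finite S \<and> presentation G S R \<and> rec_enum_words S R)"

section \<open>Effectively closed subshifts\<close>

definition full_shift :: "('g, 'b) monoid_scheme \<Rightarrow> 'a set \<Rightarrow> ('g \<Rightarrow> 'a) set" where
  "full_shift G A = carrier G \<rightarrow>\<^sub>E A"

definition shift :: "('g, 'b) monoid_scheme \<Rightarrow> 'g \<Rightarrow> ('g \<Rightarrow> 'a) \<Rightarrow> 'g \<Rightarrow> 'a" where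
  "shift G g x = (\<lambda>h\<in>carrier G. x (inv\<^bsub>G\<^esub> g \<otimes>\<^bsub>G\<^esub> h))"

definition subshift :: "('g, 'b) monoid_scheme \<Rightarrow> 'a set \<Rightarrow> ('g \<Rightarrow> 'a) set \<Rightarrow> bool" where
  "subshift G A X \<longleftrightarrow>
     closedin (product_topology (\<lambda>_. discrete_topology A) (carrier G)) X \<and>
     (\<forall>g\<in>carrier G. shift G g ` X \<subseteq> X)"

definition cylinder :: "('g, 'b) monoid_scheme \<Rightarrow> 'a set \<Rightarrow> 'a \<Rightarrow> 'g \<Rightarrow> ('g \<Rightarrow> 'a) set" where
  "cylinder G A a g = {x \<in> full_shift G A. x g = a}"

definition pattern_codings :: "'g set \<Rightarrow> 'a set \<Rightarrow> ('g list \<times> 'a) set set" where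
  "pattern_codings S A = {c. finite c \<and> c \<subseteq> lists S \<times> A}"

text \<open>The outer intersection with the full shift only matters when \<open>C\<close> is empty.\<close>

definition shift_of_codings ::
  "('g, 'b) monoid_scheme \<Rightarrow> 'a set \<Rightarrow> ('g list \<times> 'a) set set \<Rightarrow> ('g \<Rightarrow> 'a) set" where
  "shift_of_codings G A C = full_shift G A \<inter>
     (\<Inter>g\<in>carrier G. \<Inter>c\<in>C.
        full_shift G A - (\<Inter>(w, a)\<in>c. cylinder G A a (g \<otimes>\<^bsub>G\<^esub> word_val G w)))"

definition effectively_closed ::
  "('g, 'b) monoid_scheme \<Rightarrow> 'g set \<Rightarrow> 'a set \<Rightarrow> ('g \<Rightarrow> 'a) set \<Rightarrow> bool" where
  "effectively_closed G S A X \<longleftrightarrow>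
     (\<exists>C. C \<subseteq> pattern_codings S A \<and> rec_enum_codings S A C \<and> X = shift_of_codings G A C)"

end

theory Submission
  imports Defs
begin

text \<open>A configuration \<open>x\<close> lies outside \<open>X\<^sub>C \<union> X\<^sub>D\<close> iff some coding \<open>c \<in> C\<close> occurs in \<open>x\<close> at some
  position \<open>g\<close> and some \<open>d \<in> D\<close> occurs at some position \<open>h\<close>. Because \<open>S\<close> generates \<open>G\<close> as a monoid,
  \<open>h = g w\<close> for a word \<open>w\<close> over \<open>S\<close>, and then the two occurrences are one occurrence at \<open>g\<close> of
  the coding \<open>c \<union> w d\<close>, where \<open>w d\<close> prefixes every word of \<open>d\<close> with \<open>w\<close>. Hence
  \<open>X\<^sub>C \<union> X\<^sub>D\<close> is defined by all codings \<open>c \<union> w d\<close>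
  (\<open>shift_of_join_codings\<close>). Here \<open>w\<close> runs over all words, an effectively
  listable set. Different alphabets are first made equal by also
  forbidding each new letter, which takes finitely many one-letter codings
  (\<open>effectively_closed_mono_alphabet\<close>); then a finite union is an iterated binary one.

  The bulk of the work is to see that the codings \<open>c \<union> w d\<close> are recursively enumerable
  (\<open>rec_enum_join_codings\<close>). On codes, prefixing one letter is a recursive function
  of the letter and the coding, so all translates \<open>w d\<close> are obtained by closing the codes of \<open>D\<close> under
  finitely many recursive functions, and such a closure is recursively enumerable
  (\<open>rec_enum_foldr\<close>). Union is a recursive function of two codes, and the image of
  recursively enumerable sets under such a function is recursively enumerable
  (\<open>rec_enum_image2\<close>). That the two functions on codes are recursive comes down to reading and
  setting binary digits, since a finite set of numbers is coded by its binary digits, and to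
  inverting the Cantor pairing function.

  For the topological half, the full shift over a smaller alphabet is closed in the one over a larger
  alphabet and carries the subspace topology.\<close>

section \<open>Recursive functions up to extensional equality\<close>

text \<open>The predicate \<open>recursive\<close> fixes the values on argument lists of the wrong length, so it is not
  invariant under rewriting a function to one that agrees on all lists of length \<open>n\<close>; this
  version is. Its closure rules below have conclusions \<open>computable n (\<lambda>xs. \<dots>)\<close> that follow the
  shape of the term, so that computability is proved by introduction rules alone.\<close>
definition computable :: "nat \<Rightarrow> (nat list \<Rightarrow> nat) \<Rightarrow> bool" where
  "computable n f \<longleftrightarrow> (\<exists>f'. recursive n f' \<and> (\<forall>xs. length xs = n \<longrightarrow> f xs = f' xs))"

lemma computable_recursive: "recursive n f \<Longrightarrow> computable n f"
  unfolding computable_def by blast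

lemma computable_cong:
  assumes "computable n f" "\<And>xs. length xs = n \<Longrightarrow> g xs = f xs"
  shows "computable n g"
  using assms unfolding computable_def by auto

lemma computable_comp:
  assumes "computable (length gs) f" "\<And>g. g \<in> set gs \<Longrightarrow> computable n g"
  shows "computable n (\<lambda>xs. f (map (\<lambda>g. g xs) gs))"
proof -
  obtain f' where f': "recursive (length gs) f'" "\<And>xs. length xs = length gs \<Longrightarrow> f xs = f' xs"
    using assms(1) unfolding computable_def by blast
  have "\<forall>g\<in>set gs. \<exists>g'. recursive n g' \<and> (\<forall>xs. length xs = n \<longrightarrow> g xs = g' xs)"
    using assms(2) unfolding computable_def by blast
  then obtain T where T: "\<And>g. g \<in> set gs \<Longrightarrow> recursive n (T g)"
      "\<And>g xs. g \<in> set gs \<Longrightarrow> length xs = n \<Longrightarrow> g xs = T g xs"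
    by metis
  have "recursive n (\<lambda>xs. f' (map (\<lambda>g. g xs) (map T gs)))"
    by (rule recursive.comp) (use f'(1) T(1) in auto)
  moreover have "f (map (\<lambda>g. g xs) gs) = f' (map (\<lambda>g. g xs) (map T gs))" if "length xs = n" for xs
  proof -
    have "map (\<lambda>g. g xs) gs = map (\<lambda>g. g xs) (map T gs)"
      using T(2) that by simp
    moreover have "f (map (\<lambda>g. g xs) gs) = f' (map (\<lambda>g. g xs) gs)"
      by (rule f'(2)) simp
    ultimately show ?thesis by (simp only:)
  qed
  ultimately show ?thesis unfolding computable_def by blast
qed

lemma computable_nth: "i < n \<Longrightarrow> computable n (\<lambda>xs. xs ! i)"
  by (intro computable_recursive recursive.proj)

lemma computable_nth_drop: "k + i < n \<Longrightarrow> computable n (\<lambda>xs. drop k xs ! i)"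
  by (rule computable_cong[OF computable_nth[of "k + i"]]) auto

lemma computable_compose1:
  assumes "computable 1 (\<lambda>xs. F (xs ! 0))" "computable n f"
  shows "computable n (\<lambda>xs. F (f xs))"
  using computable_comp[of "[f]" "\<lambda>xs. F (xs ! 0)" n] assms by simp

lemma computable_compose2:
  assumes "computable 2 (\<lambda>xs. F (xs ! 0) (xs ! 1))" "computable n f" "computable n g"
  shows "computable n (\<lambda>xs. F (f xs) (g xs))"
proof -
  have "computable (length [f, g]) (\<lambda>xs. F (xs ! 0) (xs ! 1))"
    using assms(1) by (simp add: numeral_2_eq_2)
  from computable_comp[OF this, of n] show ?thesis using assms(2,3) by auto
qed

text \<open>Weakening: inside the step of a recursion the parameters sit behind the counter and the
  accumulator, so facts about the parameters have to be moved there.\<close>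
lemma computable_drop:
  assumes "computable n f"
  shows "computable (k + n) (\<lambda>xs. f (drop k xs))"
proof (rule computable_cong)
  show "computable (k + n) (\<lambda>xs. f (map (\<lambda>g. g xs) (map (\<lambda>i xs. xs ! (k + i)) [0..<n])))"
    by (rule computable_comp) (auto simp: assms intro!: computable_nth)
  show "f (drop k xs) = f (map (\<lambda>g. g xs) (map (\<lambda>i xs. xs ! (k + i)) [0..<n]))"
    if "length xs = k + n" for xs :: "nat list"
  proof -
    have "drop k xs = map (\<lambda>g. g xs) (map (\<lambda>i xs. xs ! (k + i)) [0..<n])"
      using that by (intro nth_equalityI) auto
    then show ?thesis by simp
  qed
qed

lemma computable_Suc:
  assumes "computable n f"
  shows "computable n (\<lambda>xs. Suc (f xs))"
proof (rule computable_compose1[OF _ assms])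
  show "computable 1 (\<lambda>xs. Suc (xs ! 0))"
    by (rule computable_cong[OF computable_recursive[OF recursive.succ]])
       (auto simp: length_Suc_conv)
qed

lemma computable_const: "computable n (\<lambda>_. c)"
proof (induction c)
  case 0
  show ?case by (intro computable_recursive recursive.zero)
next
  case (Suc c)
  then show ?case by (rule computable_Suc)
qed

text \<open>Primitive recursion on a computed argument \<open>t\<close> in which the parameters \<open>xs\<close> stay available:
  compose the basic recursion, which consumes its first argument, with \<open>t\<close> followed by all
  projections.\<close>
lemma computable_rec_nat:
  assumes "computable n b"
    and "computable (Suc (Suc n)) (\<lambda>ys. s (ys ! 0) (ys ! 1) (drop 2 ys))"
    and "computable n t"
  shows "computable n (\<lambda>xs. rec_nat (b xs) (\<lambda>k r. s k r xs) (t xs))"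
proof -
  obtain b' where b': "recursive n b'" "\<And>xs. length xs = n \<Longrightarrow> b xs = b' xs"
    using assms(1) unfolding computable_def by blast
  obtain s' where s': "recursive (Suc (Suc n)) s'"
      "\<And>ys. length ys = Suc (Suc n) \<Longrightarrow> s (ys ! 0) (ys ! 1) (drop 2 ys) = s' ys"
    using assms(2) unfolding computable_def by blast
  let ?p = "\<lambda>xs. rec_nat (b' (tl xs)) (\<lambda>k r. s' (k # r # tl xs)) (hd xs)"
  let ?gs = "t # map (\<lambda>i xs. xs ! i) [0..<n]"
  have "computable (Suc n) ?p"
    by (intro computable_recursive recursive.prim_rec b' s')
  then have "computable n (\<lambda>xs. ?p (map (\<lambda>g. g xs) ?gs))"
    by (intro computable_comp) (auto simp: assms(3) intro: computable_nth)
  then show ?thesis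
  proof (rule computable_cong)
    fix xs :: "nat list" assume len: "length xs = n"
    have "map (\<lambda>g. g xs) ?gs = t xs # xs"
      using len by (auto intro: nth_equalityI)
    moreover have "s' (k # r # xs) = s k r xs" for k r
      using s'(2)[of "k # r # xs"] len by simp
    ultimately show "rec_nat (b xs) (\<lambda>k r. s k r xs) (t xs) = ?p (map (\<lambda>g. g xs) ?gs)"
      using b'(2)[OF len] by simp
  qed
qed

lemma computable_Least:
  assumes "computable (Suc n) (\<lambda>ys. f (ys ! 0) (drop 1 ys))"
    and "\<And>xs. length xs = n \<Longrightarrow> \<exists>y. f y xs = 0"
  shows "computable n (\<lambda>xs. LEAST y. f y xs = 0)"
proof -
  obtain f' where f': "recursive (Suc n) f'"
      "\<And>ys. length ys = Suc n \<Longrightarrow> f (ys ! 0) (drop 1 ys) = f' ys"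
    using assms(1) unfolding computable_def by blast
  have eq: "f' (y # xs) = f y xs" if "length xs = n" for y xs
    using f'(2)[of "y # xs"] that by simp
  have "computable n (\<lambda>xs. LEAST y. f' (y # xs) = 0)"
    by (intro computable_recursive recursive.minim f') (simp add: eq assms(2))
  then show ?thesis
    by (rule computable_cong) (simp add: eq)
qed

section \<open>Arithmetic\<close>

lemma computable_add:
  assumes "computable n f" "computable n g"
  shows "computable n (\<lambda>xs. f xs + g xs)"
proof -
  have "computable n (\<lambda>xs. rec_nat (f xs) (\<lambda>k r. Suc r) (g xs))"
    by (intro computable_rec_nat assms computable_Suc computable_nth) auto
  moreover have "rec_nat x (\<lambda>k r. Suc r) y = x + y" for x y :: nat
    by (induction y) auto
  ultimately show ?thesis by simp
qed

text \<open>Truncated subtraction is iterated predecessor, and the predecessor is the recursion that returns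
  its counter and ignores its accumulator.\<close>
lemma computable_diff:
  assumes "computable n f" "computable n g"
  shows "computable n (\<lambda>xs. f xs - g xs)"
proof -
  have pred: "computable m (\<lambda>xs. rec_nat 0 (\<lambda>k r. k) (h xs))" if "computable m h" for m h
    by (intro computable_rec_nat that computable_const computable_nth) auto
  have "computable n (\<lambda>xs. rec_nat (f xs) (\<lambda>k r. rec_nat 0 (\<lambda>k r. k) r) (g xs))"
    by (intro computable_rec_nat assms pred computable_nth) auto
  moreover have "rec_nat 0 (\<lambda>k r. k) x = x - 1" for x :: nat
    by (cases x) auto
  moreover have "rec_nat x (\<lambda>k r. r - 1) y = x - y" for x y :: nat
    by (induction y) auto
  ultimately show ?thesis by simp
qed

lemma computable_if_zero:
  assumes "computable n c" "computable n f" "computable n g"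
  shows "computable n (\<lambda>xs. if c xs = 0 then f xs else g xs)"
proof -
  have "computable n (\<lambda>xs. rec_nat (f xs) (\<lambda>k r. g xs) (c xs))"
    using computable_drop[OF assms(3), of 2]
    by (intro computable_rec_nat assms(1,2)) simp
  moreover have "rec_nat x (\<lambda>k r. y) z = (if z = 0 then x else y)" for x y :: nat and z :: nat
    by (cases z) auto
  ultimately show ?thesis by simp
qed

text \<open>Parity and halving are recursions on the number itself: parity flips at each step, and the half
  grows at each step that starts from an odd number. Together they give the binary digits.\<close>
lemma computable_mod2:
  assumes "computable n f"
  shows "computable n (\<lambda>xs. f xs mod 2)"
proof -
  have "computable n (\<lambda>xs. rec_nat 0 (\<lambda>k r. 1 - r) (f xs))"
    by (intro computable_rec_nat assms computable_diff computable_const computable_nth) auto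
  moreover have "rec_nat 0 (\<lambda>k r. 1 - r) x = x mod 2" for x :: nat
    by (induction x) (auto simp: mod_Suc)
  ultimately show ?thesis by simp
qed

lemma computable_div2:
  assumes "computable n f"
  shows "computable n (\<lambda>xs. f xs div 2)"
proof -
  have "computable n (\<lambda>xs. rec_nat 0 (\<lambda>k r. r + k mod 2) (f xs))"
    by (intro computable_rec_nat assms computable_add computable_mod2 computable_const
        computable_nth) auto
  moreover have "rec_nat 0 (\<lambda>k r. r + k mod 2) x = x div 2" for x :: nat
    by (induction x) (auto, presburger)
  ultimately show ?thesis by simp
qed

lemma computable_power2:
  assumes "computable n f"
  shows "computable n (\<lambda>xs. 2 ^ f xs)"
proof -
  have "computable n (\<lambda>xs. rec_nat 1 (\<lambda>k r. r + r) (f xs))"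
    by (intro computable_rec_nat assms computable_add computable_const computable_nth) auto
  moreover have "rec_nat 1 (\<lambda>k r. r + r) x = (2::nat) ^ x" for x
    by (induction x) auto
  ultimately show ?thesis by simp
qed

lemma computable_div_power2:
  assumes "computable n f" "computable n g"
  shows "computable n (\<lambda>xs. f xs div 2 ^ g xs)"
proof -
  have "computable n (\<lambda>xs. rec_nat (f xs) (\<lambda>k r. r div 2) (g xs))"
    by (intro computable_rec_nat assms computable_div2 computable_nth) auto
  moreover have "rec_nat x (\<lambda>k r. r div 2) y = x div 2 ^ y" for x y :: nat
    by (induction y) (simp_all add: div_mult2_eq[symmetric] mult.commute)
  ultimately show ?thesis by simp
qed

section \<open>Codes of pairs\<close>

lemma computable_triangle:
  assumes "computable n f"
  shows "computable n (\<lambda>xs. triangle (f xs))"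
proof -
  have "computable n (\<lambda>xs. rec_nat 0 (\<lambda>k r. r + Suc k) (f xs))"
    by (intro computable_rec_nat assms computable_add computable_Suc computable_const
        computable_nth) auto
  moreover have "rec_nat 0 (\<lambda>k r. r + Suc k) x = triangle x" for x
    by (induction x) auto
  ultimately show ?thesis by simp
qed

lemma computable_prod_encode:
  assumes "computable n f" "computable n g"
  shows "computable n (\<lambda>xs. prod_encode (f xs, g xs))"
  unfolding prod_encode_def split
  by (intro computable_add computable_triangle assms)

lemma triangle_mono: "m \<le> n \<Longrightarrow> triangle m \<le> triangle n"
  unfolding triangle_def by (intro div_le_mono mult_le_mono) auto

text \<open>The least \<open>s\<close> with \<open>z < triangle (Suc s)\<close>, which is the sum of the two components coded by \<open>z\<close>. The
  inequality is written as a vanishing truncated difference, the form required by minimisation.\<close>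
definition triangle_root :: "nat \<Rightarrow> nat" where
  "triangle_root z = (LEAST s. Suc z - triangle (Suc s) = 0)"

lemma triangle_root_prod_encode: "triangle_root (prod_encode (a, b)) = a + b"
  unfolding triangle_root_def
proof (rule Least_equality)
  show "Suc (prod_encode (a, b)) - triangle (Suc (a + b)) = 0"
    by (simp add: prod_encode_def)
next
  fix s assume s: "Suc (prod_encode (a, b)) - triangle (Suc s) = 0"
  show "a + b \<le> s"
  proof (rule ccontr)
    assume "\<not> a + b \<le> s"
    then have "triangle (Suc s) \<le> triangle (a + b)" by (intro triangle_mono) simp
    then show False using s by (simp add: prod_encode_def)
  qed
qed

text \<open>Cantor decoding: the diagonal \<open>triangle_root z\<close> is the sum of the components, and the offset on that
  diagonal is the first component.\<close>
lemma prod_decode_triangle_root: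
  "fst (prod_decode z) = z - triangle (triangle_root z)"
  "snd (prod_decode z) = triangle_root z - fst (prod_decode z)"
proof -
  obtain a b where "z = prod_encode (a, b)"
    by (metis prod_decode_inverse surj_pair)
  then show "fst (prod_decode z) = z - triangle (triangle_root z)"
      "snd (prod_decode z) = triangle_root z - fst (prod_decode z)"
    by (simp_all only: triangle_root_prod_encode prod_encode_inverse fst_conv snd_conv)
       (simp_all add: prod_encode_def)
qed

lemma computable_triangle_root:
  assumes "computable n f"
  shows "computable n (\<lambda>xs. triangle_root (f xs))"
proof (rule computable_compose1[OF _ assms])
  have "\<exists>y. Suc z - triangle (Suc y) = 0" for z
    by (rule exI[of _ z]) simp
  then show "computable 1 (\<lambda>xs. triangle_root (xs ! 0))"
    unfolding triangle_root_def
    by (intro computable_Least computable_diff computable_Suc computable_triangle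
        computable_nth computable_nth_drop) auto
qed

lemma computable_prod_decode:
  assumes "computable n f"
  shows "computable n (\<lambda>xs. fst (prod_decode (f xs)))"
    and "computable n (\<lambda>xs. snd (prod_decode (f xs)))"
  unfolding prod_decode_triangle_root
  by (intro computable_diff computable_triangle computable_triangle_root assms)+

section \<open>Codes of finite sets\<close>

text \<open>The binary digits of \<open>set_encode M\<close> are the indicator function of \<open>M\<close>, so inserting an element sets
  one digit.\<close>
lemma set_encode_insert_bit:
  "set_encode (insert i (set_decode x)) = (if (x div 2 ^ i) mod 2 = 0 then x + 2 ^ i else x)"
proof (cases "i \<in> set_decode x")
  case True
  then show ?thesis
    by (simp add: insert_absorb) (simp add: set_decode_def even_iff_mod_2_eq_zero)
next
  case False
  then have "set_encode (insert i (set_decode x)) = 2 ^ i + x" by simp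
  moreover have "(x div 2 ^ i) mod 2 = 0"
    using False by (simp add: set_decode_def even_iff_mod_2_eq_zero)
  ultimately show ?thesis by simp
qed

lemma computable_set_insert:
  assumes "computable n f" "computable n g"
  shows "computable n (\<lambda>xs. set_encode (insert (f xs) (set_decode (g xs))))"
  unfolding set_encode_insert_bit
  by (intro computable_if_zero computable_mod2 computable_div_power2 computable_add
      computable_power2 assms)

lemma set_decode_less:
  assumes "i \<in> set_decode x"
  shows "i < x"
proof (rule ccontr)
  assume "\<not> i < x"
  then have "x < 2 ^ i" using less_exp[of i] by (meson le_less_trans not_less)
  then show False using assms by (simp add: set_decode_def)
qed

text \<open>A loop over the binary digits of \<open>y\<close>: whenever digit \<open>i\<close> is set, insert \<open>h i\<close> into the
  accumulator, which starts as \<open>x\<close>. Running the loop up to \<open>y\<close> itself sees every digit, by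
  \<open>i < 2 ^ i \<le> y\<close>.\<close>
lemma set_encode_Un_image_rec:
  "set_encode (set_decode x \<union> h ` set_decode y) =
    rec_nat x (\<lambda>i r. if (y div 2 ^ i) mod 2 = 0 then r else set_encode (insert (h i) (set_decode r))) y"
proof -
  let ?s = "\<lambda>i r. if (y div 2 ^ i) mod 2 = 0 then r
    else set_encode (insert (h i) (set_decode r))"
  have "rec_nat x ?s k = set_encode (set_decode x \<union> h ` (set_decode y \<inter> {..<k}))" for k
  proof (induction k)
    case (Suc k)
    show ?case
    proof (cases "k \<in> set_decode y")
      case True
      then have "set_decode y \<inter> {..<Suc k} = insert k (set_decode y \<inter> {..<k})"
        by (auto simp: lessThan_Suc)
      then show ?thesis
        using Suc True by (auto simp: set_decode_def[of y] even_iff_mod_2_eq_zero)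
    next
      case False
      then have "set_decode y \<inter> {..<Suc k} = set_decode y \<inter> {..<k}"
        by (auto simp: lessThan_Suc)
      then show ?thesis
        using Suc False by (simp add: set_decode_def[of y] even_iff_mod_2_eq_zero)
    qed
  qed simp
  moreover have "set_decode y \<inter> {..<y} = set_decode y"
    using set_decode_less by auto
  ultimately show ?thesis by simp
qed

text \<open>One rule for both operations on codings: \<open>h\<close> the identity gives unions, and \<open>f\<close> the code of
  the empty set gives images. The parameter \<open>a\<close> will be the prefixed letter.\<close>
lemma computable_set_Un_image:
  assumes h: "computable 2 (\<lambda>xs. h (xs ! 0) (xs ! 1))"
    and "computable n a" "computable n f" "computable n g"
  shows "computable n (\<lambda>xs. set_encode (set_decode (f xs) \<union> h (a xs) ` set_decode (g xs)))"
proof -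
  have drop2: "computable (Suc (Suc n)) (\<lambda>ys. u (drop 2 ys))" if "computable n u" for u
    using computable_drop[OF that, of 2] by simp
  show ?thesis
    unfolding set_encode_Un_image_rec
    by (intro computable_rec_nat computable_if_zero computable_mod2 computable_div_power2
        computable_set_insert computable_compose2[OF h] drop2 computable_nth assms) auto
qed

section \<open>Recursively enumerable sets\<close>

lemma rec_enumI:
  assumes f: "computable 1 (\<lambda>xs. f (xs ! 0))" and B: "B = range f"
  shows "rec_enum B"
proof -
  obtain f' where "recursive 1 f'" and f': "\<And>xs. length xs = 1 \<Longrightarrow> f (xs ! 0) = f' xs"
    using f unfolding computable_def by blast
  moreover have "f k = f' [k]" for k using f'[of "[k]"] by simp
  then have "B = range (\<lambda>k. f' [k])" using B by simp
  ultimately show ?thesis unfolding rec_enum_def by blast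
qed

lemma rec_enumE:
  assumes "rec_enum B"
  obtains (empty) "B = {}" | (range) f where "computable 1 (\<lambda>xs. f (xs ! 0))" "B = range f"
proof -
  consider "B = {}" | f where "recursive 1 f" "B = range (\<lambda>k. f [k])"
    using assms unfolding rec_enum_def by blast
  then show ?thesis
  proof cases
    case 2
    have "computable 1 (\<lambda>xs. f [xs ! 0])"
      by (rule computable_cong[OF computable_recursive[OF 2(1)]]) (auto simp: length_Suc_conv)
    then show ?thesis using 2(2) by (rule range)
  qed (rule empty)
qed

text \<open>Output the new element first and shift the given enumeration by one.\<close>
lemma rec_enum_insert:
  assumes "rec_enum B"
  shows "rec_enum (insert x B)"
  using assms
proof (cases rule: rec_enumE)
  case empty
  then show ?thesis by (intro rec_enumI[OF computable_const[of 1 x]]) auto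
next
  case (range f)
  let ?g = "\<lambda>k. if k = 0 then x else f (k - 1)"
  have "computable 1 (\<lambda>xs. ?g (xs ! 0))"
    by (intro computable_if_zero computable_compose1[OF range(1)] computable_diff computable_nth
        computable_const) auto
  moreover have "insert x B = range ?g"
  proof -
    have "f k \<in> range ?g" for k
      by (rule range_eqI[of _ _ "Suc k"]) simp
    moreover have "x \<in> range ?g"
      by (rule range_eqI[of _ _ 0]) simp
    ultimately show ?thesis unfolding range(2) by auto
  qed
  ultimately show ?thesis by (rule rec_enumI)
qed

lemma rec_enum_Un_finite:
  assumes "finite F" "rec_enum B"
  shows "rec_enum (B \<union> F)"
  using assms by (induction F) (auto intro: rec_enum_insert)

lemma rec_enum_finite: "finite F \<Longrightarrow> rec_enum F"
  using rec_enum_Un_finite[of F "{}"] by (simp add: rec_enum_def)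

lemma rec_enum_image2:
  assumes F: "computable 2 (\<lambda>xs. F (xs ! 0) (xs ! 1))"
    and B: "rec_enum B" and D: "rec_enum D"
  shows "rec_enum {F x y |x y. x \<in> B \<and> y \<in> D}"
proof (cases "B = {} \<or> D = {}")
  case True
  then have "{F x y |x y. x \<in> B \<and> y \<in> D} = {}" by auto
  then show ?thesis by (simp add: rec_enum_def)
next
  case False
  then obtain f g where f: "computable 1 (\<lambda>xs. f (xs ! 0))" "B = range f"
      and g: "computable 1 (\<lambda>xs. g (xs ! 0))" "D = range g"
    using B D by (elim rec_enumE) auto
  let ?h = "\<lambda>k. F (f (fst (prod_decode k))) (g (snd (prod_decode k)))"
  have "computable 1 (\<lambda>xs. ?h (xs ! 0))"
    by (intro computable_compose2[OF F] computable_compose1[OF f(1)] computable_compose1[OF g(1)]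
        computable_prod_decode computable_nth) auto
  moreover have "{F x y |x y. x \<in> B \<and> y \<in> D} = range ?h"
  proof -
    have "F (f i) (g j) \<in> range ?h" for i j
      by (rule range_eqI[of _ _ "prod_encode (i, j)"]) simp
    then show ?thesis unfolding f(2) g(2) by auto
  qed
  ultimately show ?thesis by (rule rec_enumI)
qed

text \<open>The closure of \<open>B\<close> under the unary functions \<open>F a\<close>, \<open>a \<in> L\<close>, is recursively enumerable. The
  enumeration runs a machine whose state is the pair of a tape \<open>v\<close> and a value: each step removes
  the first entry \<open>j\<close> from the tape, read as a code of a pair, and applies \<open>F (t j)\<close> to the value, where
  \<open>t\<close> enumerates \<open>L\<close>.
  An index of the enumeration codes the number of steps, the initial tape and the
  initial element. Every number is a tape of any length, because decoding pairs is total,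
  so every index yields an element of the closure; conversely, every finite sequence of letters can be
  written on a tape.\<close>
lemma rec_enum_foldr:
  assumes F: "computable 2 (\<lambda>xs. F (xs ! 0) (xs ! 1))"
    and L: "rec_enum L" and B: "rec_enum B"
  shows "rec_enum {foldr F as b |as b. as \<in> lists L \<and> b \<in> B}"
proof (cases "L = {} \<or> B = {}")
  case True
  then have "{foldr F as b |as b. as \<in> lists L \<and> b \<in> B} = B" by auto
  then show ?thesis using B by simp
next
  case False
  then obtain t f where t: "computable 1 (\<lambda>xs. t (xs ! 0))" "L = range t"
      and f: "computable 1 (\<lambda>xs. f (xs ! 0))" "B = range f"
    using L B by (elim rec_enumE) auto
  \<comment> \<open>The number \<open>?fst (?fst z)\<close> is the next tape entry of the state \<open>z\<close>.\<close>
  let ?fst = "\<lambda>z. fst (prod_decode z)" and ?snd = "\<lambda>z. snd (prod_decode z)"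
  let ?step = "\<lambda>z. prod_encode (?snd (?fst z), F (t (?fst (?fst z))) (?snd z))"
  let ?iter = "\<lambda>j z. rec_nat z (\<lambda>_. ?step) j"
  let ?g = "\<lambda>k. ?snd (?iter (?fst k) (prod_encode (?fst (?snd k), f (?snd (?snd k)))))"
  have "computable 1 (\<lambda>xs. ?g (xs ! 0))"
    by (intro computable_prod_decode computable_rec_nat computable_prod_encode
        computable_compose2[OF F] computable_compose1[OF t(1)] computable_compose1[OF f(1)]
        computable_nth) auto
  moreover have "{foldr F as b |as b. as \<in> lists L \<and> b \<in> B} = range ?g"
  proof (intro subset_antisym subsetI)
    fix y assume "y \<in> {foldr F as b |as b. as \<in> lists L \<and> b \<in> B}"
    then obtain as i where as: "as \<in> lists L" and y: "y = foldr F as (f i)"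
      using f(2) by auto
    \<comment> \<open>\<open>foldr\<close> applies the last letter first, so the tape holds the letters of \<open>as\<close> in reverse. The
      rest \<open>v\<close> of the tape is arbitrary, to leave room for the letter that the induction adds.\<close>
    have "\<exists>u. ?iter (length as) (prod_encode (u, f i)) = prod_encode (v, foldr F as (f i))" for v
      using as
    proof (induction arbitrary: v)
      case Nil
      show ?case by (rule exI[of _ v]) simp
    next
      case (Cons a as)
      obtain j where j: "a = t j" using Cons.hyps(1) t(2) by auto
      obtain u where "?iter (length as) (prod_encode (u, f i)) =
          prod_encode (prod_encode (j, v), foldr F as (f i))"
        using Cons.IH[of "prod_encode (j, v)"] by auto
      then show ?case by (intro exI[of _ u]) (simp add: j)
    qed
    then obtain u where u: "?iter (length as) (prod_encode (u, f i)) =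
        prod_encode (0, foldr F as (f i))" by blast
    show "y \<in> range ?g"
      by (rule range_eqI[of _ _ "prod_encode (length as, prod_encode (u, i))"]) (simp add: u y)
  next
    fix y assume "y \<in> range ?g"
    then obtain k where y: "y = ?g k" by blast
    let ?i = "?snd (?snd k)"
    have "\<exists>as\<in>lists L. ?snd (?iter j (prod_encode (u, f ?i))) = foldr F as (f ?i)" for j u
    proof (induction j)
      case 0
      show ?case by (rule bexI[of _ "[]"]) auto
    next
      case (Suc j)
      then obtain as where as: "as \<in> lists L"
          "?snd (?iter j (prod_encode (u, f ?i))) = foldr F as (f ?i)" by blast
      let ?a = "t (?fst (?fst (?iter j (prod_encode (u, f ?i)))))"
      have "?a # as \<in> lists L" using as(1) t(2) by simp
      then show ?case by (rule rev_bexI) (simp add: as(2))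
    qed
    then show "y \<in> {foldr F as b |as b. as \<in> lists L \<and> b \<in> B}"
      unfolding y using f(2) by blast
  qed
  ultimately show ?thesis by (rule rec_enumI)
qed

section \<open>Translating pattern codings\<close>

definition translate_coding :: "'s list \<Rightarrow> ('s list \<times> 'a) set \<Rightarrow> ('s list \<times> 'a) set" where
  "translate_coding w c = (\<lambda>(u, a). (w @ u, a)) ` c"

definition join_codings ::
  "'s set \<Rightarrow> ('s list \<times> 'a) set set \<Rightarrow> ('s list \<times> 'a) set set \<Rightarrow> ('s list \<times> 'a) set set" where
  "join_codings S C D = {c \<union> translate_coding w d |c d w. c \<in> C \<and> d \<in> D \<and> w \<in> lists S}"

text \<open>The effect of prefixing a letter with number \<open>s\<close> to the word of a single pair \<open>(w, a)\<close> of a coding,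
  on the code of that pair; \<open>Suc (prod_encode (s, _))\<close> is the cons operation of \<open>list_encode\<close>.\<close>
definition cons_code :: "nat \<Rightarrow> nat \<Rightarrow> nat" where
  "cons_code s z = prod_encode (Suc (prod_encode (s, fst (prod_decode z))), snd (prod_decode z))"

definition translate_code :: "nat \<Rightarrow> nat \<Rightarrow> nat" where
  "translate_code s m = set_encode (cons_code s ` set_decode m)"

lemma computable_translate_code:
  "computable 2 (\<lambda>xs. translate_code (xs ! 0) (xs ! 1))"
proof -
  have "computable 2 (\<lambda>xs. cons_code (xs ! 0) (xs ! 1))"
    unfolding cons_code_def
    by (intro computable_prod_encode computable_Suc computable_prod_decode computable_nth) auto
  then have "computable 2 (\<lambda>xs. set_encode (set_decode 0 \<union> cons_code (xs ! 0) ` set_decode (xs ! 1)))"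
    by (intro computable_set_Un_image computable_const computable_nth) auto
  then show ?thesis unfolding translate_code_def by simp
qed

lemma computable_union_code:
  "computable 2 (\<lambda>xs. set_encode (set_decode (xs ! 0) \<union> set_decode (xs ! 1)))"
proof -
  have "computable 2 (\<lambda>xs. set_encode (set_decode (xs ! 0) \<union> (\<lambda>z. z) ` set_decode (xs ! 1)))"
    by (rule computable_set_Un_image[where h = "\<lambda>_ z. z" and a = "\<lambda>_. 0"])
       (intro computable_const computable_nth; simp)+
  then show ?thesis by simp
qed

lemma finite_translate_coding: "finite c \<Longrightarrow> finite (translate_coding w c)"
  unfolding translate_coding_def by simp

lemma set_decode_coding_encode:
  "finite c \<Longrightarrow> set_decode (coding_encode e d c) =
    (\<lambda>(w, a). prod_encode (list_encode (map e w), d a)) ` c"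
  unfolding coding_encode_def by simp

lemma coding_encode_Un:
  "finite b \<Longrightarrow> finite c \<Longrightarrow> coding_encode e d (b \<union> c) =
    set_encode (set_decode (coding_encode e d b) \<union> set_decode (coding_encode e d c))"
  by (simp only: set_decode_coding_encode) (simp add: coding_encode_def image_Un)

text \<open>On codes, translation by a word is a composition of translations by single letters. This is
  what brings the translates into the scope of \<open>rec_enum_foldr\<close>.\<close>
lemma coding_encode_translate:
  assumes "finite c"
  shows "coding_encode e d (translate_coding w c) =
    foldr translate_code (map e w) (coding_encode e d c)"
proof (induction w)
  case Nil
  have "translate_coding [] c = c" unfolding translate_coding_def by force
  then show ?case by simp
next
  case (Cons s w)
  let ?enc = "\<lambda>(w, a). prod_encode (list_encode (map e w), d a)"
  have "?enc ` translate_coding (s # w) c = cons_code (e s) ` ?enc ` translate_coding w c"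
    unfolding translate_coding_def image_image
    by (intro image_cong) (auto simp: cons_code_def)
  then have "coding_encode e d (translate_coding (s # w) c) =
      translate_code (e s) (coding_encode e d (translate_coding w c))"
    using finite_translate_coding[OF assms, of w]
    by (simp add: translate_code_def set_decode_coding_encode) (simp add: coding_encode_def)
  then show ?case using Cons.IH by simp
qed

lemma rec_enum_join_codings:
  fixes S :: "'s set" and A :: "'a set"
  assumes S: "finite S"
    and fin: "\<And>c. c \<in> C \<Longrightarrow> finite c" "\<And>c. c \<in> D \<Longrightarrow> finite c"
    and C: "rec_enum_codings S A C" and D: "rec_enum_codings S A D"
  shows "rec_enum_codings S A (join_codings S C D)"
  unfolding rec_enum_codings_def
proof (intro allI impI)
  fix e :: "'s \<Rightarrow> nat" and d :: "'a \<Rightarrow> nat"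
  assume inj: "inj_on e S" "inj_on d A"
  let ?T = "{foldr translate_code as b |as b. as \<in> lists (e ` S) \<and> b \<in> coding_encode e d ` D}"
  let ?U = "\<lambda>x y. set_encode (set_decode x \<union> set_decode y)"
  have "rec_enum ?T"
  proof (rule rec_enum_foldr[OF computable_translate_code])
    show "rec_enum (e ` S)" using S by (intro rec_enum_finite finite_imageI)
    show "rec_enum (coding_encode e d ` D)"
      using D inj unfolding rec_enum_codings_def by blast
  qed
  then have codes: "rec_enum {?U x y |x y. x \<in> coding_encode e d ` C \<and> y \<in> ?T}"
    using C inj unfolding rec_enum_codings_def
    by (intro rec_enum_image2 computable_union_code) auto
  have translates: "?T = {coding_encode e d (translate_coding w c) |w c. w \<in> lists S \<and> c \<in> D}"
  proof -
    have "?T = {foldr translate_code (map e w) (coding_encode e d c) |w c. w \<in> lists S \<and> c \<in> D}"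
      unfolding lists_image by blast
    also have "\<dots> = {coding_encode e d (translate_coding w c) |w c. w \<in> lists S \<and> c \<in> D}"
      by (rule Collect_cong) (metis coding_encode_translate fin(2))
    finally show ?thesis .
  qed
  have regroup: "{U x y |x y. x \<in> f ` C \<and> y \<in> {g w b |w b. w \<in> lists S \<and> b \<in> D}} =
      {U (f c) (g w b) |c w b. c \<in> C \<and> w \<in> lists S \<and> b \<in> D}"
    for U :: "nat \<Rightarrow> nat \<Rightarrow> nat" and f g
    by fastforce
  have "coding_encode e d ` join_codings S C D =
      {?U x y |x y. x \<in> coding_encode e d ` C \<and>
        y \<in> {coding_encode e d (translate_coding w c) |w c. w \<in> lists S \<and> c \<in> D}}"
  proof -
    have "coding_encode e d ` join_codings S C D =
        {coding_encode e d (c \<union> translate_coding w b) |c w b. c \<in> C \<and> w \<in> lists S \<and> b \<in> D}"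
      unfolding join_codings_def by blast
    also have "\<dots> = {?U (coding_encode e d c) (coding_encode e d (translate_coding w b)) |c w b.
        c \<in> C \<and> w \<in> lists S \<and> b \<in> D}"
      by (rule Collect_cong) (metis coding_encode_Un finite_translate_coding fin)
    finally show ?thesis
      unfolding regroup .
  qed
  then show "rec_enum (coding_encode e d ` join_codings S C D)"
    using codes unfolding translates by (simp only:)
qed

section \<open>Unions of effectively closed sets\<close>

definition occurs_at ::
  "('g, 'b) monoid_scheme \<Rightarrow> ('g \<Rightarrow> 'a) \<Rightarrow> ('g list \<times> 'a) set \<Rightarrow> 'g \<Rightarrow> bool" where
  "occurs_at G x c g \<longleftrightarrow> (\<forall>(w, a)\<in>c. x (g \<otimes>\<^bsub>G\<^esub> word_val G w) = a)"

text \<open>Membership in terms of forbidden occurrences; every later argument about \<open>shift_of_codings\<close> uses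
  this form instead of cylinders.\<close>
lemma mem_shift_of_codings:
  "x \<in> shift_of_codings G A C \<longleftrightarrow>
    x \<in> full_shift G A \<and> (\<forall>g\<in>carrier G. \<forall>c\<in>C. \<not> occurs_at G x c g)"
proof -
  have "(\<forall>p\<in>c. x \<in> (case p of (w, a) \<Rightarrow> cylinder G A a (g \<otimes>\<^bsub>G\<^esub> word_val G w))) \<longleftrightarrow>
      occurs_at G x c g"
    if "x \<in> full_shift G A" for c g
    using that by (simp add: cylinder_def occurs_at_def case_prod_beta)
  then show ?thesis
    unfolding shift_of_codings_def Int_iff INT_iff Diff_iff by (simp cong: conj_cong)
qed

context group
begin

lemma word_val_closed: "w \<in> lists (carrier G) \<Longrightarrow> word_val G w \<in> carrier G"
  by (induction w) (auto simp: word_val_def)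

lemma word_val_append:
  "u \<in> lists (carrier G) \<Longrightarrow> v \<in> lists (carrier G) \<Longrightarrow>
    word_val G (u @ v) = word_val G u \<otimes> word_val G v"
proof (induction u)
  case Nil
  then show ?case using word_val_closed[of v] by (simp add: word_val_def)
next
  case (Cons s u)
  have "word_val G (s # w) = s \<otimes> word_val G w" for w by (simp add: word_val_def)
  then show ?case
    using Cons word_val_closed[of u] word_val_closed[of v] by (simp add: m_assoc)
qed

text \<open>Since \<open>S\<close> is closed under inverses, the group it generates consists of values of words
  without formal inverses.\<close>
lemma word_val_surj:
  assumes "sym_generating_set G S" "g \<in> carrier G"
  shows "\<exists>w\<in>lists S. word_val G w = g"
proof -
  have S: "S \<subseteq> carrier G" "\<And>s. s \<in> S \<Longrightarrow> inv s \<in> S" "generate G S = carrier G"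
    using assms(1) unfolding sym_generating_set_def by auto
  have "g \<in> generate G S" using assms(2) S(3) by simp
  then show ?thesis
  proof induction
    case one
    show ?case by (rule bexI[of _ "[]"]) (auto simp: word_val_def)
  next
    case (incl s)
    then show ?case using S(1) by (intro bexI[of _ "[s]"]) (auto simp: word_val_def)
  next
    case (inv s)
    then show ?case using S(1,2) by (intro bexI[of _ "[inv s]"]) (auto simp: word_val_def)
  next
    case (eng g h)
    then obtain u v where "u \<in> lists S" "v \<in> lists S" "word_val G u = g" "word_val G v = h"
      by blast
    moreover from this have "u \<in> lists (carrier G)" "v \<in> lists (carrier G)"
      using S(1) by auto
    ultimately show ?case by (intro bexI[of _ "u @ v"]) (auto simp: word_val_append)
  qed
qed

lemma occurs_at_join:
  assumes "w \<in> lists (carrier G)" "\<And>u a. (u, a) \<in> d \<Longrightarrow> u \<in> lists (carrier G)" "g \<in> carrier G"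
  shows "occurs_at G x (c \<union> translate_coding w d) g \<longleftrightarrow>
    occurs_at G x c g \<and> occurs_at G x d (g \<otimes> word_val G w)"
proof -
  have "g \<otimes> word_val G (w @ u) = g \<otimes> word_val G w \<otimes> word_val G u" if "u \<in> fst ` d" for u
  proof -
    have "u \<in> lists (carrier G)" using assms(2) that by force
    then show ?thesis
      using assms(1,3) word_val_closed[of u] word_val_closed[of w]
      by (simp add: word_val_append m_assoc)
  qed
  then show ?thesis
    unfolding occurs_at_def translate_coding_def by (simp add: case_prod_beta ball_Un)
qed

text \<open>Occurrences of \<open>c\<close> at \<open>g\<close> and of \<open>d\<close> at \<open>h\<close> combine to one occurrence at \<open>g\<close>, of \<open>c\<close> joined with
  the translate of \<open>d\<close> by any word for \<open>g\<^sup>-\<^sup>1 h\<close>.\<close>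
lemma shift_of_join_codings:
  assumes S: "sym_generating_set G S" and D: "D \<subseteq> pattern_codings S A"
  shows "shift_of_codings G A (join_codings S C D) =
    shift_of_codings G A C \<union> shift_of_codings G A D"
proof -
  have SG: "lists S \<subseteq> lists (carrier G)"
    using S unfolding sym_generating_set_def by (intro lists_mono) auto
  have words: "u \<in> lists (carrier G)" if "d \<in> D" "(u, a) \<in> d" for d u a
    using that D SG unfolding pattern_codings_def by blast
  have join: "occurs_at G x (c \<union> translate_coding w d) g \<longleftrightarrow>
      occurs_at G x c g \<and> occurs_at G x d (g \<otimes> word_val G w)"
    if "w \<in> lists S" "d \<in> D" "g \<in> carrier G" for x c w d g
    by (rule occurs_at_join) (use that SG words in auto)
  have iff: "(\<exists>g\<in>carrier G. \<exists>b\<in>join_codings S C D. occurs_at G x b g) \<longleftrightarrow>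
      (\<exists>g\<in>carrier G. \<exists>c\<in>C. occurs_at G x c g) \<and> (\<exists>g\<in>carrier G. \<exists>d\<in>D. occurs_at G x d g)" for x
  proof
    assume "\<exists>g\<in>carrier G. \<exists>b\<in>join_codings S C D. occurs_at G x b g"
    then obtain g c d w where g: "g \<in> carrier G" "c \<in> C" "d \<in> D" "w \<in> lists S"
        and "occurs_at G x (c \<union> translate_coding w d) g"
      unfolding join_codings_def by blast
    then have "occurs_at G x c g" "occurs_at G x d (g \<otimes> word_val G w)"
      using join by auto
    moreover have "g \<otimes> word_val G w \<in> carrier G"
      using g SG word_val_closed by blast
    ultimately show "(\<exists>g\<in>carrier G. \<exists>c\<in>C. occurs_at G x c g) \<and>
        (\<exists>g\<in>carrier G. \<exists>d\<in>D. occurs_at G x d g)" using g by blast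
  next
    assume "(\<exists>g\<in>carrier G. \<exists>c\<in>C. occurs_at G x c g) \<and>
        (\<exists>g\<in>carrier G. \<exists>d\<in>D. occurs_at G x d g)"
    then obtain g c h d where gh: "g \<in> carrier G" "c \<in> C" "occurs_at G x c g"
        "h \<in> carrier G" "d \<in> D" "occurs_at G x d h" by blast
    obtain w where w: "w \<in> lists S" "word_val G w = inv g \<otimes> h"
      using word_val_surj[OF S, of "inv g \<otimes> h"] gh by blast
    then have "g \<otimes> word_val G w = h"
      using gh by (simp add: m_assoc[symmetric])
    then have "occurs_at G x (c \<union> translate_coding w d) g"
      using join[OF w(1) gh(5,1)] gh by simp
    moreover have "c \<union> translate_coding w d \<in> join_codings S C D"
      unfolding join_codings_def using gh w by blast
    ultimately show "\<exists>g\<in>carrier G. \<exists>b\<in>join_codings S C D. occurs_at G x b g"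
      using gh(1) by blast
  qed
  show ?thesis
  proof (rule Set.set_eqI)
    fix x
    show "x \<in> shift_of_codings G A (join_codings S C D) \<longleftrightarrow>
        x \<in> shift_of_codings G A C \<union> shift_of_codings G A D"
      unfolding Un_iff mem_shift_of_codings using iff[of x] by blast
  qed
qed

lemma effectively_closed_Un:
  assumes S: "sym_generating_set G S"
    and "effectively_closed G S A X" "effectively_closed G S A Y"
  shows "effectively_closed G S A (X \<union> Y)"
proof -
  obtain C D where C: "C \<subseteq> pattern_codings S A" "rec_enum_codings S A C" "X = shift_of_codings G A C"
      and D: "D \<subseteq> pattern_codings S A" "rec_enum_codings S A D" "Y = shift_of_codings G A D"
    using assms unfolding effectively_closed_def by blast
  have "join_codings S C D \<subseteq> pattern_codings S A"
    using C(1) D(1)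
    by (fastforce simp: join_codings_def translate_coding_def pattern_codings_def)
  moreover have "rec_enum_codings S A (join_codings S C D)"
    by (rule rec_enum_join_codings)
       (use S C D in \<open>auto simp: sym_generating_set_def pattern_codings_def\<close>)
  ultimately show ?thesis
    unfolding effectively_closed_def using shift_of_join_codings[OF S D(1)] C(3) D(3) by blast
qed

text \<open>The letters of \<open>B - A\<close> are excluded by the codings that place such a letter at the empty word,
  that is, at every position of the group. There are finitely many of them, so
  adding them preserves recursive enumerability.\<close>
lemma effectively_closed_mono_alphabet:
  assumes "effectively_closed G S A X" "A \<subseteq> B" "finite B"
  shows "effectively_closed G S B X"
proof -
  obtain C where C: "C \<subseteq> pattern_codings S A" "rec_enum_codings S A C" "X = shift_of_codings G A C"
    using assms(1) unfolding effectively_closed_def by blast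
  let ?E = "(\<lambda>b. {([], b)}) ` (B - A)"
  have "C \<union> ?E \<subseteq> pattern_codings S B"
    using C(1) assms(2) by (auto simp: pattern_codings_def)
  moreover have "rec_enum_codings S B (C \<union> ?E)"
    unfolding rec_enum_codings_def image_Un
  proof (intro allI impI rec_enum_Un_finite finite_imageI)
    fix e :: "'a \<Rightarrow> nat" and d :: "'c \<Rightarrow> nat"
    assume "inj_on e S" "inj_on d B"
    then show "rec_enum (coding_encode e d ` C)"
      using C(2) assms(2) inj_on_subset unfolding rec_enum_codings_def by blast
  qed (use assms(3) in auto)
  moreover have "X = shift_of_codings G B (C \<union> ?E)"
  proof -
    have "occurs_at G x {([], b)} g \<longleftrightarrow> x g = b" if "g \<in> carrier G" for x :: "'a \<Rightarrow> 'c" and b g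
      using that by (simp add: occurs_at_def word_val_def)
    then have "x \<in> full_shift G A \<longleftrightarrow>
        x \<in> full_shift G B \<and> (\<forall>g\<in>carrier G. \<forall>c\<in>?E. \<not> occurs_at G x c g)" for x
      using assms(2) unfolding full_shift_def PiE_iff by (auto, blast)
    then show ?thesis unfolding C(3) by (auto simp: mem_shift_of_codings)
  qed
  ultimately show ?thesis unfolding effectively_closed_def by blast
qed

lemma effectively_closed_UN:
  assumes S: "sym_generating_set G S" and "finite I" "I \<noteq> {}"
    and "\<And>i. i \<in> I \<Longrightarrow> effectively_closed G S A (X i)"
  shows "effectively_closed G S A (\<Union>i\<in>I. X i)"
  using assms(2-4)
  by (induction rule: finite_ne_induct) (auto intro: effectively_closed_Un[OF S])

end

section \<open>Unions of subshifts\<close>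

text \<open>The set \<open>A\<close> is closed in the discrete space \<open>B\<close>, hence so is the product of copies of \<open>A\<close> in that of
  copies of \<open>B\<close>; closed sets of a closed subspace are closed.\<close>
lemma subshift_mono_alphabet:
  assumes "subshift G A X" "A \<subseteq> B"
  shows "subshift G B X"
proof -
  let ?T = "product_topology (\<lambda>_. discrete_topology B) (carrier G)"
  have "subtopology ?T (carrier G \<rightarrow>\<^sub>E A) = product_topology (\<lambda>_. discrete_topology A) (carrier G)"
    using assms(2) by (simp add: subtopology_product_topology Int_absorb1)
  moreover have "closedin ?T (carrier G \<rightarrow>\<^sub>E A)"
    using assms(2) by (simp add: closedin_product_topology)
  ultimately have "closedin ?T X"
    using assms(1) unfolding subshift_def by (metis closedin_closed_subtopology)
  then show ?thesis using assms(1) unfolding subshift_def by blast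
qed

lemma subshift_UN:
  assumes "finite I" "\<And>i. i \<in> I \<Longrightarrow> subshift G A (X i)"
  shows "subshift G A (\<Union>i\<in>I. X i)"
  unfolding subshift_def
proof (intro conjI ballI)
  show "closedin (product_topology (\<lambda>_. discrete_topology A) (carrier G)) (\<Union>i\<in>I. X i)"
    using assms unfolding subshift_def by (intro closedin_Union) auto
  show "shift G g ` (\<Union>i\<in>I. X i) \<subseteq> (\<Union>i\<in>I. X i)" if "g \<in> carrier G" for g
    using assms(2) that unfolding subshift_def by blast
qed

theorem proposition2p6:
  fixes G :: "('g, 'b) monoid_scheme"
    and S :: "'g set"
    and n :: nat
    and A :: "nat \<Rightarrow> 'a set"
    and X :: "nat \<Rightarrow> ('g \<Rightarrow> 'a) set"
  assumes "group G"
    and "sym_generating_set G S"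
    and "recursively_presented G"
    and "n \<ge> 1"
    and "\<And>i. i \<in> {1..n} \<Longrightarrow> finite (A i)"
    and "\<And>i. i \<in> {1..n} \<Longrightarrow> subshift G (A i) (X i)"
    and "\<And>i. i \<in> {1..n} \<Longrightarrow> effectively_closed G S (A i) (X i)"
  shows "subshift G (\<Union>i\<in>{1..n}. A i) (\<Union>i\<in>{1..n}. X i) \<and>
    effectively_closed G S (\<Union>i\<in>{1..n}. A i) (\<Union>i\<in>{1..n}. X i)"
proof
  interpret group G by fact
  let ?B = "\<Union>i\<in>{1..n}. A i"
  show "subshift G ?B (\<Union>i\<in>{1..n}. X i)"
    by (intro subshift_UN subshift_mono_alphabet[OF assms(6)]) auto
  have fin: "finite ?B" using assms(5) by (intro finite_UN_I) auto
  show "effectively_closed G S ?B (\<Union>i\<in>{1..n}. X i)"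
    by (intro effectively_closed_UN[OF assms(2)]
        effectively_closed_mono_alphabet[OF assms(7) _ fin]) (use assms(4) in auto)
qed

end
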